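(* Let $n \ge 4$ be even, let $D_n = \langle x, t \mid x^n = t^2 = 1,\ txt = x^{-1}\rangle$ and $C_n = \langle x \rangle \le D_n$. Let $M$ be a maximal skew set in $C_n$ containing precisely one element from each coset of $\langle x^{n/2}\rangle$ in $C_n$ other than $\langle x^{n/2}\rangle$ itself, and set $S = M \cup Mt \subseteq D_n$, where $Mt = \{mt : m \in M\}$. Then $S \cup \{t\}$ and $S \cup \{x^{n/2}t\}$ are both $(2n, n-1, \frac{n-2}{2})$ sum sets in $D_n$ which are type 1 with respect to $Z(D_n) = \{1, x^{n/2}\}$.
   Context: A subset $T$ of a group is skew if $T \cap T^{(-1)} = \varnothing$, where $T^{(-1)}=\{s^{-1}: s\in T\}$; a maximal skew set is a skew subset not properly contained in any other skew subset. For a finite group $X$ of order $w$, $T\subseteq X$ with $|T|=k$ is a $(w,k,\mu)$ sum set if every nonidentity element $a\in X$ admits exactly $\mu$ ordered pairs $(y_1,y_2)\in T\times T$ with $y_1y_2 = a$. For a normal subgroup $N$ of order $2$, a sum set $T$ is type 1 with respect to $N$ if $T\cap N=\varnothing$ and $T$ meets each other coset of $N$ in $0$ or $1$ elements. *)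

theory Defs
  imports "HOL-Algebra.Generated_Groups"
begin

section \<open>Group presentations\<close>

text \<open>A group word over the generating symbols \<open>'g\<close> is a list of letters; the letter
  \<open>(g, True)\<close> stands for \<open>g\<close> and \<open>(g, False)\<close> for its inverse.\<close>

type_synonym 'g group_word = "('g \<times> bool) list"

text \<open>\<open>consequence R u v\<close> holds if the equation \<open>u = v\<close> follows from the group axioms and the
  relations \<open>l = r\<close> with \<open>(l, r) \<in> R\<close>.\<close>

inductive consequence ::
  "('g group_word \<times> 'g group_word) set \<Rightarrow> 'g group_word \<Rightarrow> 'g group_word \<Rightarrow> bool"
  for R where
  refl: "consequence R u u"
| sym: "consequence R u v \<Longrightarrow> consequence R v u"
| trans: "consequence R u v \<Longrightarrow> consequence R v w \<Longrightarrow> consequence R u w"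
| cancel: "consequence R (u @ [(g, b), (g, \<not> b)] @ v) (u @ v)"
| relation: "(l, r) \<in> R \<Longrightarrow> consequence R (u @ l @ v) (u @ r @ v)"

fun word_value :: "('a, 'b) monoid_scheme \<Rightarrow> ('g \<Rightarrow> 'a) \<Rightarrow> 'g group_word \<Rightarrow> 'a" where
  "word_value G f [] = \<one>\<^bsub>G\<^esub>"
| "word_value G f ((g, b) # w) =
     (if b then f g else inv\<^bsub>G\<^esub> (f g)) \<otimes>\<^bsub>G\<^esub> word_value G f w"

text \<open>\<open>presented_by G f R\<close>: via the assignment \<open>f\<close> of elements of \<open>G\<close> to the symbols,
  \<open>G\<close> is the group with the presentation \<open>\<langle>'g | R\<rangle>\<close>.
  That is, \<open>f\<close> induces an isomorphism from the free group on \<open>'g\<close> modulo the normal closure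
  of the relators onto \<open>G\<close>.\<close>

definition presented_by ::
  "('a, 'b) monoid_scheme \<Rightarrow> ('g \<Rightarrow> 'a) \<Rightarrow> ('g group_word \<times> 'g group_word) set \<Rightarrow> bool" where
  "presented_by G f R \<longleftrightarrow>
     group G \<and> range f \<subseteq> carrier G \<and> generate G (range f) = carrier G \<and>
     (\<forall>u v. word_value G f u = word_value G f v \<longleftrightarrow> consequence R u v)"


section \<open>Dihedral groups\<close>

datatype dihedral_gen = Gen_x | Gen_t

definition dihedral_relations :: "nat \<Rightarrow> (dihedral_gen group_word \<times> dihedral_gen group_word) set"
  where
  "dihedral_relations n =
     {(replicate n (Gen_x, True), []),
      ([(Gen_t, True), (Gen_t, True)], []),
      ([(Gen_t, True), (Gen_x, True), (Gen_t, True)], [(Gen_x, False)])}"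

definition is_dihedral :: "nat \<Rightarrow> ('a, 'b) monoid_scheme \<Rightarrow> 'a \<Rightarrow> 'a \<Rightarrow> bool" where
  "is_dihedral n G x t \<longleftrightarrow> presented_by G (case_dihedral_gen x t) (dihedral_relations n)"

definition group_center :: "('a, 'b) monoid_scheme \<Rightarrow> 'a set" where
  "group_center G = {z \<in> carrier G. \<forall>g \<in> carrier G. z \<otimes>\<^bsub>G\<^esub> g = g \<otimes>\<^bsub>G\<^esub> z}"


section \<open>Skew sets and sum sets\<close>

definition skew :: "('a, 'b) monoid_scheme \<Rightarrow> 'a set \<Rightarrow> bool" where
  "skew G T \<longleftrightarrow> T \<subseteq> carrier G \<and> T \<inter> set_inv\<^bsub>G\<^esub> T = {}"

definition maximal_skew :: "('a, 'b) monoid_scheme \<Rightarrow> 'a set \<Rightarrow> bool" where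
  "maximal_skew G T \<longleftrightarrow> skew G T \<and> \<not> (\<exists>T'. skew G T' \<and> T \<subset> T')"

definition sum_set :: "('a, 'b) monoid_scheme \<Rightarrow> nat \<Rightarrow> nat \<Rightarrow> nat \<Rightarrow> 'a set \<Rightarrow> bool" where
  "sum_set G w k \<mu> T \<longleftrightarrow>
     group G \<and> finite (carrier G) \<and> order G = w \<and> T \<subseteq> carrier G \<and> card T = k \<and>
     (\<forall>a \<in> carrier G - {\<one>\<^bsub>G\<^esub>}. card {(y1, y2) \<in> T \<times> T. y1 \<otimes>\<^bsub>G\<^esub> y2 = a} = \<mu>)"

definition type1 :: "('a, 'b) monoid_scheme \<Rightarrow> 'a set \<Rightarrow> 'a set \<Rightarrow> bool" where
  "type1 G N T \<longleftrightarrow>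
     N \<lhd> G \<and> card N = 2 \<and> T \<inter> N = {} \<and>
     (\<forall>K \<in> rcosets\<^bsub>G\<^esub> N - {N}. card (T \<inter> K) \<in> {0, 1})"

end

theory Submission
  imports Defs "HOL-Algebra.Multiplicative_Group"
begin

text \<open>Let C be the group of rotations and z its unique involution; the other elements are the
  reflections \<open>c \<otimes> t\<close>. For u in {1, z} put T = M \<union> (M \<union> {u})t;
  the two choices of u give the two sets of the theorem, so one argument serves both.

  Factorisations of a within T correspond to those y in T for which y^-1 a is in T. Since t c = c^-1
  t, sorting y into rotations and reflections gives the same four terms for a = c (with c not 1) and
  for a = ct: the y in M with y^-1 c in M; the y in M with y c^-1 in M; the y in M with y^-1 c = u;
  and y = u, if u c^-1 is in M. As y c^-1 is the inverse of y^-1 c, skewness and maximality make the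
  first two terms count every y in M except those in {c, zc}. If c is not in {1, z}, exactly one
  element of M is lost in this way because M is a transversal. The last two terms ask whether d = uc
  or its inverse is in M, and exactly one of them is. If c is in {1, z}, nothing is lost and nothing
  is gained. So the total is always |M| = (n - 2)/2; see \<open>card_M_split\<close> and
  \<open>card_pairs\<close>. \<open>type1_T\<close> treats the cosets of {1, z}.

  The presentation serves to supply the structural facts about C, t and z. The lower bounds (x has
  order n, t is not a rotation) come from the invariants \<open>word_sign\<close> and
  \<open>word_shift\<close>.\<close>

section \<open>Groups with an abelian subgroup of index 2 inverted by an involution\<close>

locale generalized_dihedral = group G for G (structure) +
  fixes C :: "'a set" and t z :: 'a
  assumes subgroup_C: "subgroup C G"
    and finite_C: "finite C"
    and C_comm: "\<lbrakk>a \<in> C; b \<in> C\<rbrakk> \<Longrightarrow> a \<otimes> b = b \<otimes> a"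
    and t_carrier: "t \<in> carrier G"
    and t_notin_C: "t \<notin> C"
    and t_square: "t \<otimes> t = \<one>"
    and t_conj: "c \<in> C \<Longrightarrow> t \<otimes> c = inv c \<otimes> t"
    and carrier_eq: "carrier G = C \<union> (C #> t)"
    and z_in_C: "z \<in> C"
    and z_neq_one: "z \<noteq> \<one>"
    and z_square: "z \<otimes> z = \<one>"
    and square_eq_one: "\<lbrakk>c \<in> C; c \<otimes> c = \<one>\<rbrakk> \<Longrightarrow> c = \<one> \<or> c = z"
begin

lemma C_carrier: "c \<in> C \<Longrightarrow> c \<in> carrier G"
  using subgroup_C subgroup.mem_carrier by metis

lemma C_closed [simp, intro]:
  "\<one> \<in> C" "a \<in> C \<Longrightarrow> inv a \<in> C" "\<lbrakk>a \<in> C; b \<in> C\<rbrakk> \<Longrightarrow> a \<otimes> b \<in> C"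
  using subgroup_C by (auto simp: subgroup_def)

lemma inv_z: "inv z = z"
  using z_square z_in_C C_carrier by (simp add: inv_equality)

lemma inv_eq_self_iff: "c \<in> C \<Longrightarrow> inv c = c \<longleftrightarrow> c = \<one> \<or> c = z"
  using square_eq_one inv_z C_carrier by (metis inv_one r_inv)

lemma z_mult_notin_center:
  assumes "c \<in> C" "c \<noteq> \<one>" "c \<noteq> z"
  shows "z \<otimes> c \<noteq> \<one>" "z \<otimes> c \<noteq> z"
proof -
  have cz: "c \<in> carrier G" "z \<in> carrier G"
    using assms(1) z_in_C C_carrier by auto
  show "z \<otimes> c \<noteq> \<one>"
  proof
    assume "z \<otimes> c = \<one>"
    then have "inv c = z"
      using cz by (simp add: inv_equality)
    then show False
      using assms(3) cz inv_z by (metis inv_inv)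
  qed
  show "z \<otimes> c \<noteq> z"
    using assms(2) cz by simp
qed

lemma carrier_cases:
  assumes "g \<in> carrier G"
  obtains c where "c \<in> C" "g = c" | c where "c \<in> C" "g = c \<otimes> t"
  using assms carrier_eq by (auto simp: r_coset_def)

lemma reflection_notin_C: "c \<in> C \<Longrightarrow> c \<otimes> t \<notin> C"
  by (metis C_carrier C_closed(2,3) inv_solve_left t_carrier t_notin_C)

lemma reflection_inject: "\<lbrakk>a \<in> C; b \<in> C\<rbrakk> \<Longrightarrow> a \<otimes> t = b \<otimes> t \<longleftrightarrow> a = b"
  using C_carrier t_carrier by simp

lemma reflection_mult: "\<lbrakk>y \<in> C; c \<in> C\<rbrakk> \<Longrightarrow> (y \<otimes> t) \<otimes> c = (y \<otimes> inv c) \<otimes> t"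
  using C_carrier t_carrier by (simp add: m_assoc t_conj)

lemma reflection_mult_reflection:
  assumes "y \<in> C" "c \<in> C"
  shows "(y \<otimes> t) \<otimes> (c \<otimes> t) = y \<otimes> inv c"
proof -
  have "(y \<otimes> t) \<otimes> (c \<otimes> t) = (y \<otimes> t \<otimes> c) \<otimes> t"
    using assms C_carrier t_carrier by (simp add: m_assoc)
  also have "\<dots> = (y \<otimes> inv c) \<otimes> t \<otimes> t"
    using assms by (simp only: reflection_mult)
  also have "\<dots> = y \<otimes> inv c"
    using assms C_carrier t_carrier by (simp add: m_assoc t_square)
  finally show ?thesis .
qed

lemma inv_reflection: "y \<in> C \<Longrightarrow> inv (y \<otimes> t) = y \<otimes> t"
  using reflection_mult_reflection[of y y] C_carrier t_carrier
  by (simp add: inv_equality)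

lemma card_carrier: "card (carrier G) = 2 * card C"
proof -
  have "C #> t = (\<lambda>c. c \<otimes> t) ` C"
    by (auto simp: r_coset_def)
  moreover have "inj_on (\<lambda>c. c \<otimes> t) C"
    using reflection_inject by (auto intro: inj_onI)
  ultimately have "card (C #> t) = card C" "finite (C #> t)"
    using finite_C by (auto simp: card_image)
  moreover have "C \<inter> (C #> t) = {}"
    using reflection_notin_C by (auto simp: r_coset_def)
  ultimately show ?thesis
    using finite_C by (simp add: carrier_eq card_Un_disjoint)
qed

lemma finite_carrier: "finite (carrier G)"
  using finite_C by (auto simp: carrier_eq r_coset_def)

lemma z_central: "g \<in> carrier G \<Longrightarrow> z \<otimes> g = g \<otimes> z"
proof (elim carrier_cases)
  fix c assume c: "c \<in> C" "g = c \<otimes> t"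
  have "g \<otimes> z = c \<otimes> z \<otimes> t"
    using c z_in_C by (simp add: reflection_mult inv_z)
  also have "\<dots> = z \<otimes> g"
    using c z_in_C C_carrier t_carrier C_comm[of c z] by (simp add: m_assoc)
  finally show ?thesis by simp
qed (use C_comm z_in_C in auto)

text \<open>A rotation commuting with \<open>t\<close> is its own inverse, hence
  \<open>\<one>\<close> or \<open>z\<close>. A reflection commuting with a rotation \<open>d\<close>
  forces \<open>inv d = d\<close>, so the assumed \<open>d\<close> rules out reflections.\<close>

lemma group_center_eq:
  assumes "\<exists>d\<in>C. d \<noteq> \<one> \<and> d \<noteq> z"
  shows "group_center G = {\<one>, z}"
proof
  show "{\<one>, z} \<subseteq> group_center G"
    using z_central z_in_C C_carrier by (auto simp: group_center_def)
  show "group_center G \<subseteq> {\<one>, z}"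
  proof
    fix g assume "g \<in> group_center G"
    then have g: "g \<in> carrier G" "\<And>h. h \<in> carrier G \<Longrightarrow> g \<otimes> h = h \<otimes> g"
      by (auto simp: group_center_def)
    from g(1) show "g \<in> {\<one>, z}"
    proof (cases rule: carrier_cases)
      case (1 c)
      then have "inv c = c"
        using g(2)[OF t_carrier] t_conj[of c] reflection_inject[of c "inv c"] by simp
      then show ?thesis using 1 inv_eq_self_iff by auto
    next
      case (2 c)
      from assms obtain d where d: "d \<in> C" "d \<noteq> \<one>" "d \<noteq> z" by blast
      have "(c \<otimes> inv d) \<otimes> t = (d \<otimes> c) \<otimes> t"
        using g(2)[of d] reflection_mult[of c d] 2 d C_carrier t_carrier by (metis m_assoc)
      then have "c \<otimes> inv d = c \<otimes> d"
        using 2 d reflection_inject C_comm[of c d] by simp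
      then have "inv d = d"
        using 2 d C_carrier by simp
      then show ?thesis using d inv_eq_self_iff by auto
    qed
  qed
qed

lemma normal_center: "{\<one>, z} \<lhd> G"
proof -
  have zc: "z \<in> carrier G"
    using z_in_C C_carrier by blast
  have "subgroup {\<one>, z} G"
    using zc by unfold_locales (auto simp: z_square inv_z)
  moreover have "g \<otimes> z \<otimes> inv g = z" if "g \<in> carrier G" for g
    using that zc by (simp add: z_central[OF that, symmetric] m_assoc)
  ultimately show ?thesis
    using zc by (auto simp: normal_inv_iff)
qed

lemma center_coset: "g \<in> carrier G \<Longrightarrow> {\<one>, z} #> g = {g, z \<otimes> g}"
  by (auto simp: r_coset_def)

end

section \<open>Counting in the set built from a skew transversal\<close>

text \<open>The two equivalences are the usable form of maximal skewness and of the coset condition.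
  The parameter \<open>u\<close> selects the extra reflection: \<open>t\<close> for
  \<open>u = \<one>\<close>, \<open>z \<otimes> t\<close> for \<open>u = z\<close>.\<close>

locale skew_transversal = generalized_dihedral +
  fixes M :: "'a set" and u :: 'a
  assumes M_subset: "M \<subseteq> C - {\<one>, z}"
    and inv_in_M_iff: "\<lbrakk>a \<in> C; a \<noteq> \<one>; a \<noteq> z\<rbrakk> \<Longrightarrow> inv a \<in> M \<longleftrightarrow> a \<notin> M"
    and z_mult_in_M_iff: "\<lbrakk>a \<in> C; a \<noteq> \<one>; a \<noteq> z\<rbrakk> \<Longrightarrow> z \<otimes> a \<in> M \<longleftrightarrow> a \<notin> M"
    and u_cases: "u = \<one> \<or> u = z"
begin

definition T :: "'a set" where
  "T = M \<union> (insert u M #> t)"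

lemma M_in_C: "m \<in> M \<Longrightarrow> m \<in> C"
  using M_subset by blast

lemma finite_M: "finite M"
  using M_subset finite_C finite_subset by blast

lemma u_in_C: "u \<in> C" and inv_u: "inv u = u" and u_notin_M: "u \<notin> M"
  using u_cases z_in_C inv_z M_subset by auto

text \<open>Inversion maps \<open>M\<close> bijectively onto its complement in
  \<open>C - {\<one>, z}\<close>.\<close>

lemma double_card_M: "2 * card M = card C - 2"
proof -
  have inj: "inj_on (\<lambda>m. inv m) M"
    using M_in_C C_carrier by (metis inj_onI inv_inv)
  have non_M: "a \<in> (\<lambda>m. inv m) ` M" if "a \<in> C - {\<one>, z}" "a \<notin> M" for a
    using that inv_in_M_iff[of a] C_carrier by (metis Diff_iff image_eqI insert_iff inv_inv)
  have inv_M: "inv m \<in> C - {\<one>, z}" "inv m \<notin> M" if "m \<in> M" for m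
  proof -
    have m: "m \<in> C" "m \<noteq> \<one>" "m \<noteq> z" "m \<in> carrier G"
      using that M_subset C_carrier by auto
    then have "inv m \<noteq> \<one>" "inv m \<noteq> z"
      using inv_z by (metis inv_inv inv_one)+
    then show "inv m \<in> C - {\<one>, z}" "inv m \<notin> M"
      using m that inv_in_M_iff by auto
  qed
  have "(\<lambda>m. inv m) ` M \<subseteq> C - {\<one>, z}"
    using inv_M(1) by (rule image_subsetI)
  moreover have "C - {\<one>, z} \<subseteq> M \<union> (\<lambda>m. inv m) ` M"
    using non_M by (metis UnI1 UnI2 subsetI)
  ultimately have "C - {\<one>, z} = M \<union> (\<lambda>m. inv m) ` M"
    using M_subset by (intro subset_antisym Un_least)
  moreover have "M \<inter> (\<lambda>m. inv m) ` M = {}"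
    using inv_M(2) by blast
  ultimately have "card (C - {\<one>, z}) = 2 * card M"
    using inj finite_M by (simp add: card_Un_disjoint card_image)
  moreover have "card (C - {\<one>, z}) = card C - 2"
    using z_in_C z_neq_one finite_C by (subst card_Diff_subset) auto
  ultimately show ?thesis by simp
qed

lemma in_T_iff: "c \<in> C \<Longrightarrow> c \<in> T \<longleftrightarrow> c \<in> M"
  using M_in_C u_in_C reflection_notin_C by (auto simp: T_def r_coset_def)

lemma reflection_in_T_iff: "c \<in> C \<Longrightarrow> c \<otimes> t \<in> T \<longleftrightarrow> c \<in> insert u M"
  using M_in_C u_in_C reflection_notin_C reflection_inject
  by (auto simp: T_def r_coset_def)

lemma T_subset: "T \<subseteq> carrier G"
  using M_in_C u_in_C C_carrier t_carrier by (auto simp: T_def r_coset_def)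

text \<open>Turns a count over \<open>T\<close> into two counts inside \<open>C\<close>, with
  reflections indexed by their rotation part.\<close>

lemma card_Collect_T:
  "card {y \<in> T. P y} = card {y \<in> M. P y} + card {y \<in> insert u M. P (y \<otimes> t)}"
proof -
  have "{y \<in> T. P y} = {y \<in> M. P y} \<union> (\<lambda>y. y \<otimes> t) ` {y \<in> insert u M. P (y \<otimes> t)}"
    by (auto simp: T_def r_coset_def)
  moreover have "{y \<in> M. P y} \<inter> (\<lambda>y. y \<otimes> t) ` {y \<in> insert u M. P (y \<otimes> t)} = {}"
    using M_in_C u_in_C reflection_notin_C by auto
  moreover have "inj_on (\<lambda>y. y \<otimes> t) {y \<in> insert u M. P (y \<otimes> t)}"
    using M_in_C u_in_C reflection_inject by (intro inj_onI) auto
  ultimately show ?thesis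
    using finite_M by (simp add: card_Un_disjoint card_image)
qed

lemma card_T: "card T = 2 * card M + 1"
proof -
  have "{y \<in> insert u M. True} = insert u M" by blast
  then show ?thesis
    using card_Collect_T[of "\<lambda>_. True"] finite_M u_notin_M by simp
qed

lemma card_pairs_eq:
  assumes "a \<in> carrier G"
  shows "card {(y1, y2) \<in> T \<times> T. y1 \<otimes> y2 = a} = card {y \<in> T. inv y \<otimes> a \<in> T}"
proof -
  have "{(y1, y2) \<in> T \<times> T. y1 \<otimes> y2 = a} = (\<lambda>y. (y, inv y \<otimes> a)) ` {y \<in> T. inv y \<otimes> a \<in> T}"
    using assms T_subset by (auto simp: inv_solve_left' image_iff subset_iff m_assoc[symmetric])
  then show ?thesis
    by (simp add: card_image inj_on_def)
qed

text \<open>For every \<open>y \<in> M\<close> outside \<open>{c, z \<otimes> c}\<close> exactly one of \<open>inv y \<otimes> c\<close> and its inverse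
  \<open>y \<otimes> inv c\<close> lies in \<open>M\<close>. If \<open>c\<close> is not in the center, one of \<open>c\<close>, \<open>z \<otimes> c\<close> lies in \<open>M\<close> and
  contributes nothing here, and the last two summands make up for it.\<close>

lemma card_M_split:
  assumes c: "c \<in> C"
  shows "card {y \<in> M. inv y \<otimes> c \<in> M} + card {y \<in> M. y \<otimes> inv c \<in> M}
      + card {y \<in> M. inv y \<otimes> c = u} + card {y \<in> {u}. y \<otimes> inv c \<in> M} = card M"
proof -
  have cc: "c \<in> carrier G" "u \<in> carrier G" "z \<in> carrier G"
    using c u_in_C z_in_C C_carrier by auto
  have eq1: "inv y \<otimes> c = \<one> \<longleftrightarrow> y = c" if "y \<in> C" for y
    using that cc C_carrier[OF that] by (metis inv_inv inv_equality inv_closed l_inv)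
  have eqz: "inv y \<otimes> c = z \<longleftrightarrow> y = z \<otimes> c" if "y \<in> C" for y
  proof -
    have "inv y \<otimes> c = z \<longleftrightarrow> c = y \<otimes> z"
      using that cc C_carrier[OF that] by (metis inv_solve_left)
    also have "\<dots> \<longleftrightarrow> c = z \<otimes> y"
      using that C_comm z_in_C by simp
    also have "\<dots> \<longleftrightarrow> y = z \<otimes> c"
      using cc C_carrier[OF that] inv_z by (metis inv_solve_left)
    finally show ?thesis .
  qed
  have inv_quot: "inv (inv y \<otimes> c) = y \<otimes> inv c" if "y \<in> C" for y
    using that c cc C_carrier[OF that] C_comm by (simp add: inv_mult_group)
  \<comment> \<open>For these \<open>y\<close> the quotient \<open>inv y \<otimes> c\<close> is
    neither \<open>\<one>\<close> nor \<open>z\<close>, so exactly one of it and its inverse lies in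
    \<open>M\<close>.\<close>
  have split: "y \<otimes> inv c \<in> M \<longleftrightarrow> inv y \<otimes> c \<notin> M" if "y \<in> C" "y \<noteq> c" "y \<noteq> z \<otimes> c" for y
    using that inv_in_M_iff[of "inv y \<otimes> c"] inv_quot[of y] eq1 eqz c by simp
  have none: "y \<otimes> inv c \<notin> M" "inv y \<otimes> c \<notin> M" if "y \<in> C" "y = c \<or> y = z \<otimes> c" for y
  proof -
    have "inv y \<otimes> c \<in> {\<one>, z}"
      using that eq1 eqz by blast
    moreover from this have "y \<otimes> inv c \<in> {\<one>, z}"
      using inv_quot[OF that(1)] inv_z by auto
    ultimately show "y \<otimes> inv c \<notin> M" "inv y \<otimes> c \<notin> M"
      using M_subset by blast+
  qed
  have union: "{y \<in> M. inv y \<otimes> c \<in> M} \<union> {y \<in> M. y \<otimes> inv c \<in> M} = M - {c, z \<otimes> c}"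
    using split none M_in_C by auto
  moreover have "{y \<in> M. inv y \<otimes> c \<in> M} \<inter> {y \<in> M. y \<otimes> inv c \<in> M} = {}"
    using split none M_in_C by blast
  ultimately have sum:
    "card {y \<in> M. inv y \<otimes> c \<in> M} + card {y \<in> M. y \<otimes> inv c \<in> M} = card (M - {c, z \<otimes> c})"
    using finite_M by (metis (no_types, lifting) card_Un_disjoint finite_Un finite_Diff)
  \<comment> \<open>\<open>d\<close> is the only solution \<open>y\<close> of
    \<open>inv y \<otimes> c = u\<close>, and its inverse is \<open>u \<otimes> inv c\<close>. Hence
    the last two summands are the indicators of \<open>d \<in> M\<close> and
    \<open>inv d \<in> M\<close>.\<close>
  define d where "d = u \<otimes> c"
  have d: "d \<in> C" "d = c \<or> d = z \<otimes> c"
    using u_cases cc c u_in_C by (auto simp: d_def)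
  have equ: "inv y \<otimes> c = u \<longleftrightarrow> y = d" if "y \<in> C" for y
    using u_cases eq1[OF that] eqz[OF that] cc by (auto simp: d_def)
  have inv_d: "u \<otimes> inv c = inv d"
    using c cc u_in_C C_comm by (simp add: d_def inv_mult_group inv_u)
  have third: "{y \<in> M. inv y \<otimes> c = u} = M \<inter> {d}"
    using equ M_in_C by auto
  have fourth: "{y \<in> {u}. y \<otimes> inv c \<in> M} = (if inv d \<in> M then {u} else {})"
    using inv_d by auto
  show ?thesis
  proof (cases "c = \<one> \<or> c = z")
    case True
    \<comment> \<open>All of \<open>c\<close>, \<open>z \<otimes> c\<close>, \<open>d\<close> and
      \<open>inv d\<close> lie in \<open>{\<one>, z}\<close>, which misses \<open>M\<close>: nothing
      is removed from \<open>M\<close> and the last two summands vanish.\<close>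
    then have "c \<notin> M" "z \<otimes> c \<notin> M" "d \<in> {\<one>, z}"
      using M_subset z_square cc d by auto
    moreover from this have "d \<notin> M" "inv d \<notin> M"
      using inv_z M_subset by auto
    ultimately show ?thesis
      using sum unfolding third fourth by simp
  next
    case False
    have zc: "z \<otimes> c \<noteq> \<one>" "z \<otimes> c \<noteq> z"
      using False c z_mult_notin_center by auto
    have "d \<noteq> \<one>" "d \<noteq> z"
      using d zc False by auto
    then have "inv d \<in> M \<longleftrightarrow> d \<notin> M"
      using inv_in_M_iff d by blast
    then have "card (M \<inter> {d}) + card (if inv d \<in> M then {u} else {}) = 1"
      by (cases "d \<in> M") auto
    moreover have "card (M - {c, z \<otimes> c}) + 1 = card M"
    proof -
      obtain e where e: "e \<in> M" "M - {c, z \<otimes> c} = M - {e}"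
        using z_mult_in_M_iff[OF c] False by (cases "c \<in> M") auto
      then show ?thesis
        using card_Suc_Diff1[OF finite_M e(1)] by (simp only: e(2) Suc_eq_plus1)
    qed
    ultimately show ?thesis
      using sum third fourth by simp
  qed
qed

text \<open>For a rotation and for a reflection the count breaks up into the four summands of
  \<open>card_M_split\<close>. Only their origin differs: the third one comes from reflections
  \<open>y \<otimes> t\<close> in the first case and from rotations \<open>y\<close> in the second,
  the fourth always from \<open>u \<otimes> t\<close>.\<close>

lemma card_pairs:
  assumes "a \<in> carrier G" "a \<noteq> \<one>"
  shows "card {(y1, y2) \<in> T \<times> T. y1 \<otimes> y2 = a} = card M"
  using assms(1)
proof (cases rule: carrier_cases)
  case (1 c)
  have "{y \<in> M. inv y \<otimes> a \<in> T} = {y \<in> M. inv y \<otimes> c \<in> M}"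
    using 1 M_in_C in_T_iff by auto
  moreover have "{y \<in> insert u M. inv (y \<otimes> t) \<otimes> a \<in> T}
      = {y \<in> M. y \<otimes> inv c \<in> M} \<union> {y \<in> M. inv y \<otimes> c = u} \<union> {y \<in> {u}. y \<otimes> inv c \<in> M}"
    (is "?L = ?R")
  proof -
    have "y \<otimes> inv c = u \<longleftrightarrow> inv y \<otimes> c = u" if "y \<in> C" for y
    proof -
      have "inv (y \<otimes> inv c) = inv y \<otimes> c"
        using that 1 C_carrier C_comm by (simp add: inv_mult_group)
      then show ?thesis
        using that 1 C_carrier inv_u u_in_C by (metis C_closed(2,3) inv_inv)
    qed
    \<comment> \<open>Here \<open>a \<noteq> \<one>\<close> enters: it excludes the factorisation of
      \<open>\<one>\<close> as the square of \<open>u \<otimes> t\<close>.\<close>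
    moreover have "u \<otimes> inv c \<noteq> u"
      using 1 assms(2) C_carrier u_in_C by (simp add: inv_eq_1_iff)
    moreover have "inv (y \<otimes> t) \<otimes> a \<in> T \<longleftrightarrow> y \<otimes> inv c \<in> insert u M" if "y \<in> C" for y
      using that 1 by (simp add: inv_reflection reflection_mult reflection_in_T_iff)
    ultimately show ?thesis
      using M_in_C u_in_C by auto
  qed
  moreover have "card ?R = card {y \<in> M. y \<otimes> inv c \<in> M} + card {y \<in> M. inv y \<otimes> c = u}
      + card {y \<in> {u}. y \<otimes> inv c \<in> M}"
  proof -
    have "y \<otimes> inv c \<notin> M" if "y \<in> M" "inv y \<otimes> c = u" for y
    proof -
      \<comment> \<open>The right-hand side is \<open>inv u = u\<close>, which is not in
        \<open>M\<close>; so the first two sets are disjoint.\<close>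
      have "y \<otimes> inv c = inv (inv y \<otimes> c)"
        using M_in_C[OF that(1)] 1 C_carrier C_comm by (simp add: inv_mult_group)
      then show ?thesis using that inv_u u_notin_M by simp
    qed
    then show ?thesis
      using finite_M u_notin_M by (subst card_Un_disjoint; (subst card_Un_disjoint)?) auto
  qed
  ultimately show ?thesis
    using card_pairs_eq[OF assms(1)] card_Collect_T[of "\<lambda>y. inv y \<otimes> a \<in> T"]
      card_M_split[of c] 1 by simp
next
  case (2 c)
  have "inv y \<otimes> a \<in> T \<longleftrightarrow> inv y \<otimes> c \<in> insert u M" if "y \<in> C" for y
    using that 2 C_carrier t_carrier reflection_in_T_iff[of "inv y \<otimes> c"] by (simp add: m_assoc)
  then have "{y \<in> M. inv y \<otimes> a \<in> T} = {y \<in> M. inv y \<otimes> c \<in> M} \<union> {y \<in> M. inv y \<otimes> c = u}"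
    using M_in_C by auto
  moreover have "{y \<in> insert u M. inv (y \<otimes> t) \<otimes> a \<in> T}
      = {y \<in> M. y \<otimes> inv c \<in> M} \<union> {y \<in> {u}. y \<otimes> inv c \<in> M}"
    using M_in_C u_in_C 2
    by (auto simp: inv_reflection reflection_mult_reflection in_T_iff)
  moreover have "card ({y \<in> M. inv y \<otimes> c \<in> M} \<union> {y \<in> M. inv y \<otimes> c = u})
      = card {y \<in> M. inv y \<otimes> c \<in> M} + card {y \<in> M. inv y \<otimes> c = u}"
    using finite_M u_notin_M by (subst card_Un_disjoint) auto
  moreover have "card ({y \<in> M. y \<otimes> inv c \<in> M} \<union> {y \<in> {u}. y \<otimes> inv c \<in> M})
      = card {y \<in> M. y \<otimes> inv c \<in> M} + card {y \<in> {u}. y \<otimes> inv c \<in> M}"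
    using finite_M u_notin_M by (subst card_Un_disjoint) auto
  ultimately show ?thesis
    using card_pairs_eq[OF assms(1)] card_Collect_T[of "\<lambda>y. inv y \<otimes> a \<in> T"]
      card_M_split[of c] 2 by simp
qed

lemma sum_set_T: "sum_set G (2 * card C) (2 * card M + 1) (card M) T"
  using group_axioms finite_carrier card_carrier T_subset card_T card_pairs
  by (auto simp: sum_set_def order_def)

text \<open>Each coset \<open>{g, z \<otimes> g}\<close> other than the center is met exactly once:
  by the transversal property of \<open>M\<close> in general, and for the coset of \<open>t\<close>
  by \<open>u \<otimes> t\<close> alone.\<close>

lemma type1_T: "type1 G {\<one>, z} T"
proof -
  have "card (T \<inter> ({\<one>, z} #> g)) = 1"
    if g: "g \<in> carrier G" "{\<one>, z} #> g \<noteq> {\<one>, z}" for g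
  proof -
    have "\<exists>!y. y \<in> T \<inter> {g, z \<otimes> g}"
      using g(1)
    proof (cases rule: carrier_cases)
      case (1 c)
      have "{c, z \<otimes> c} \<noteq> {\<one>, z}"
        using g 1 by (simp add: center_coset)
      then have "c \<noteq> \<one>" "c \<noteq> z"
        using C_carrier[OF z_in_C] z_square by (metis r_one, metis insert_commute)
      then show ?thesis
        using 1 z_mult_in_M_iff[of c] in_T_iff z_in_C by auto
    next
      case (2 c)
      have zc: "z \<otimes> g = (z \<otimes> c) \<otimes> t" "z \<otimes> c \<in> C"
        using 2 C_carrier t_carrier z_in_C by (auto simp: m_assoc)
      have "g \<in> T \<longleftrightarrow> c \<in> insert u M" "z \<otimes> g \<in> T \<longleftrightarrow> z \<otimes> c \<in> insert u M"
        using 2 zc reflection_in_T_iff by auto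
      moreover have "z \<otimes> c \<noteq> c"
        using 2 z_neq_one z_in_C C_carrier by simp
      then have "z \<otimes> g \<noteq> g"
        using 2 zc reflection_inject by simp
      moreover have "c \<in> insert u M \<longleftrightarrow> z \<otimes> c \<notin> insert u M"
      proof (cases "c = \<one> \<or> c = z")
        case True
        then show ?thesis
          using u_cases M_subset z_square z_neq_one z_in_C C_carrier by auto
      next
        case False
        then have "z \<otimes> c \<noteq> \<one>" "z \<otimes> c \<noteq> z"
          using 2 z_mult_notin_center by auto
        then show ?thesis
          using False z_mult_in_M_iff[of c] 2 u_cases by auto
      qed
      ultimately show ?thesis by auto
    qed
    then show ?thesis
      using g(1) by (simp add: center_coset card_1_singleton_iff) blast
  qed
  moreover have "T \<inter> {\<one>, z} = {}"
    using in_T_iff z_in_C M_subset by auto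
  ultimately show ?thesis
    using normal_center z_neq_one by (auto simp: type1_def RCOSETS_def)
qed

end

section \<open>Invariants of dihedral words\<close>

text \<open>Words evaluate to affine maps \<open>j \<mapsto> s * j + k\<close> of the integers, where \<open>x\<close> acts as
  \<open>j \<mapsto> j + 1\<close> and \<open>t\<close> as \<open>j \<mapsto> - j\<close>. Modulo \<open>n\<close> this satisfies the dihedral relations, which
  yields the lower bound on the order of \<open>x\<close>.\<close>

fun word_sign :: "dihedral_gen group_word \<Rightarrow> int" where
  "word_sign [] = 1"
| "word_sign ((Gen_x, b) # w) = word_sign w"
| "word_sign ((Gen_t, b) # w) = - word_sign w"

fun word_shift :: "dihedral_gen group_word \<Rightarrow> int" where
  "word_shift [] = 0"
| "word_shift ((Gen_x, b) # w) = word_shift w + (if b then 1 else - 1)"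
| "word_shift ((Gen_t, b) # w) = - word_shift w"

lemma word_sign_append: "word_sign (u @ v) = word_sign u * word_sign v"
  by (induction u rule: word_sign.induct) auto

text \<open>Concatenation of words is composition of the affine maps, the left word acting
  last.\<close>

lemma word_shift_append: "word_shift (u @ v) = word_sign u * word_shift v + word_shift u"
  by (induction u rule: word_shift.induct) (auto simp: algebra_simps)

lemma word_sign_replicate: "word_sign (replicate k (Gen_x, b)) = 1"
  by (induction k) auto

lemma word_shift_replicate: "word_shift (replicate k (Gen_x, True)) = int k"
  by (induction k) auto

lemma consequence_dihedral_sound:
  assumes "consequence (dihedral_relations n) u v"
  shows "word_sign u = word_sign v \<and> int n dvd word_shift u - word_shift v"
  using assms
proof (induction rule: consequence.induct)
  case (sym u v)
  then show ?case by (simp add: dvd_diff_commute)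
next
  case (trans u v w)
  then show ?case
    using dvd_add[of "int n" "word_shift u - word_shift v" "word_shift v - word_shift w"] by simp
next
  case (cancel u g b v)
  then show ?case
    by (cases g) (auto simp: word_sign_append word_shift_append)
next
  case (relation l r u v)
  then have "word_sign l = word_sign r" "int n dvd word_shift l - word_shift r"
    by (auto simp: dihedral_relations_def word_sign_replicate word_shift_replicate)
  \<comment> \<open>The left context contributes only a sign, and equal signs of \<open>l\<close>
    and \<open>r\<close> cancel the contribution of \<open>v\<close>.\<close>
  moreover have "word_shift (u @ l @ v) - word_shift (u @ r @ v)
      = word_sign u * ((word_sign l - word_sign r) * word_shift v + (word_shift l - word_shift r))"
    by (simp add: word_sign_append word_shift_append algebra_simps)
  ultimately show ?case
    by (simp add: word_sign_append)
qed simp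

lemma (in monoid) word_value_replicate:
  "f g \<in> carrier G \<Longrightarrow> word_value G f (replicate k (g, True)) = f g [^] k"
proof (induction k)
  case (Suc k)
  then show ?case by (simp add: nat_pow_Suc2[symmetric] del: nat_pow_Suc)
qed simp

section \<open>Structure of the dihedral group read off from its presentation\<close>

locale dihedral =
  fixes G (structure) and n :: nat and x t :: 'a
  assumes dihedral: "is_dihedral n G x t" and n_pos: "n > 0"

sublocale dihedral \<subseteq> group
  using dihedral by (simp add: is_dihedral_def presented_by_def)

context dihedral
begin

abbreviation C :: "'a set" where
  "C \<equiv> generate G {x}"

lemma range_gens: "range (case_dihedral_gen x t) = {x, t}"
proof -
  have "UNIV = {Gen_x, Gen_t}"
    using dihedral_gen.exhaust by auto
  then show ?thesis by (metis dihedral_gen.simps(3,4) image_insert image_empty)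
qed

lemma x_carrier [simp]: "x \<in> carrier G" and t_carrier [simp]: "t \<in> carrier G"
  and carrier_eq_generate: "carrier G = generate G {x, t}"
  and word_value_eq_iff: "word_value G (case_dihedral_gen x t) u = word_value G (case_dihedral_gen x t) v
    \<longleftrightarrow> consequence (dihedral_relations n) u v"
  using dihedral unfolding is_dihedral_def presented_by_def range_gens by auto

lemma word_value_relation:
  "(l, r) \<in> dihedral_relations n \<Longrightarrow>
    word_value G (case_dihedral_gen x t) l = word_value G (case_dihedral_gen x t) r"
  using consequence.relation[of l r _ "[]" "[]"] by (simp add: word_value_eq_iff)

lemma x_pow_n: "x [^] n = \<one>"
  using word_value_relation[of "replicate n (Gen_x, True)" "[]"]
  by (simp add: dihedral_relations_def word_value_replicate)

lemma t_square: "t \<otimes> t = \<one>"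
  using word_value_relation[of "[(Gen_t, True), (Gen_t, True)]" "[]"]
  by (simp add: dihedral_relations_def)

lemma t_x_t: "t \<otimes> (x \<otimes> t) = inv x"
  using word_value_relation[of "[(Gen_t, True), (Gen_x, True), (Gen_t, True)]" "[(Gen_x, False)]"]
  by (simp add: dihedral_relations_def)

text \<open>An equation \<open>x [^] k = \<one>\<close> must be derivable from the relations, and
  derivable equations preserve the shift modulo \<open>n\<close>; the shift of the word for
  \<open>x [^] k\<close> is \<open>k\<close>.\<close>

lemma x_pow_eq_one_iff: "x [^] k = \<one> \<longleftrightarrow> n dvd k" for k :: nat
proof
  assume "x [^] k = \<one>"
  then have "consequence (dihedral_relations n) (replicate k (Gen_x, True)) []"
    using word_value_eq_iff[of "replicate k (Gen_x, True)" "[]"]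
    by (simp add: word_value_replicate)
  then show "n dvd k"
    using consequence_dihedral_sound by (fastforce simp: word_shift_replicate)
next
  assume "n dvd k"
  then show "x [^] k = \<one>"
    using x_pow_n by (auto simp: nat_pow_pow[symmetric])
qed

lemma ord_x: "ord x = n"
  using x_pow_eq_one_iff by (simp add: ord_unique)

lemma C_eq: "C = {x [^] k | k. k \<in> (UNIV :: nat set)}"
  using generate_pow_nat[of x] ord_x n_pos by simp

lemma card_C: "card C = n"
  using generate_pow_card[of x] ord_x by simp

lemma subgroup_C: "subgroup C G"
  by (simp add: generate_is_subgroup)

lemma C_comm: "\<lbrakk>a \<in> C; b \<in> C\<rbrakk> \<Longrightarrow> a \<otimes> b = b \<otimes> a"
  by (auto simp: C_eq nat_pow_mult add.commute)

text \<open>Words for powers of \<open>x\<close> have sign 1, the word for \<open>t\<close> has sign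
  -1.\<close>

lemma t_notin_C: "t \<notin> C"
proof
  assume "t \<in> C"
  then obtain k :: nat where "x [^] k = t" by (auto simp: C_eq)
  then have "consequence (dihedral_relations n) (replicate k (Gen_x, True)) [(Gen_t, True)]"
    using word_value_eq_iff[of "replicate k (Gen_x, True)" "[(Gen_t, True)]"]
    by (simp add: word_value_replicate)
  then show False
    using consequence_dihedral_sound by (fastforce simp: word_sign_replicate)
qed

lemma t_conj:
  assumes "c \<in> C"
  shows "t \<otimes> c = inv c \<otimes> t"
proof -
  have t_x: "t \<otimes> x = inv x \<otimes> t"
  proof -
    have "t \<otimes> x = t \<otimes> (x \<otimes> t) \<otimes> t"
      by (simp add: m_assoc t_square)
    then show ?thesis by (simp add: t_x_t)
  qed
  have "t \<otimes> x [^] k = inv (x [^] k) \<otimes> t" for k :: nat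
  proof (induction k)
    case (Suc k)
    have "t \<otimes> x [^] Suc k = inv (x [^] k) \<otimes> (t \<otimes> x)"
      using Suc by (simp add: m_assoc[symmetric])
    also have "\<dots> = inv (x \<otimes> x [^] k) \<otimes> t"
      by (simp add: t_x m_assoc inv_mult_group)
    also have "x \<otimes> x [^] k = x [^] Suc k"
      by (metis nat_pow_Suc2 x_carrier)
    finally show ?case .
  qed simp
  then show ?thesis using assms by (auto simp: C_eq)
qed

text \<open>The right-hand side contains the generators and their inverses and is closed under
  products.\<close>

lemma carrier_eq: "carrier G = C \<union> (C #> t)"
proof
  have C_carrier: "c \<in> carrier G" if "c \<in> C" for c
    using that subgroup_C subgroup.mem_carrier by metis
  show "C \<union> (C #> t) \<subseteq> carrier G"
    using C_carrier by (auto simp: r_coset_def)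
  have inv_t: "inv t = t"
    using t_square by (simp add: inv_equality)
  have C_closed: "\<one> \<in> C" "\<And>a. a \<in> C \<Longrightarrow> inv a \<in> C" "\<And>a b. \<lbrakk>a \<in> C; b \<in> C\<rbrakk> \<Longrightarrow> a \<otimes> b \<in> C"
    using subgroup_C by (auto simp: subgroup_def)
  have x_C: "x \<in> C"
    by (auto intro: generate.incl)
  show "carrier G \<subseteq> C \<union> (C #> t)"
  proof
    fix g assume "g \<in> carrier G"
    then have "g \<in> generate G {x, t}" by (simp add: carrier_eq_generate)
    then show "g \<in> C \<union> (C #> t)"
    proof (induction rule: generate.induct)
      case (eng g h)
      \<comment> \<open>These product rules are derived directly because
        \<open>generalized_dihedral\<close> has the present decomposition among its
        assumptions.\<close>
      have refl_mult: "(a \<otimes> t) \<otimes> b = (a \<otimes> inv b) \<otimes> t" if "a \<in> C" "b \<in> C" for a b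
        using that C_carrier by (simp add: m_assoc t_conj)
      have refl_refl: "(a \<otimes> t) \<otimes> (b \<otimes> t) = a \<otimes> inv b" if "a \<in> C" "b \<in> C" for a b
      proof -
        have "(a \<otimes> t) \<otimes> (b \<otimes> t) = ((a \<otimes> t) \<otimes> b) \<otimes> t"
          using that C_carrier by (simp add: m_assoc)
        also have "\<dots> = (a \<otimes> inv b) \<otimes> t \<otimes> t"
          using that by (simp only: refl_mult)
        also have "\<dots> = a \<otimes> inv b"
          using that C_carrier by (simp add: m_assoc t_square)
        finally show ?thesis .
      qed
      have mult_refl: "a \<otimes> (b \<otimes> t) = (a \<otimes> b) \<otimes> t" if "a \<in> C" "b \<in> C" for a b
        using that C_carrier by (simp add: m_assoc)
      from eng.IH consider "g \<in> C" "h \<in> C"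
        | b where "g \<in> C" "b \<in> C" "h = b \<otimes> t"
        | a where "a \<in> C" "g = a \<otimes> t" "h \<in> C"
        | a b where "a \<in> C" "g = a \<otimes> t" "b \<in> C" "h = b \<otimes> t"
        by (auto simp: r_coset_def)
      then show ?case
      proof cases
        case (2 b)
        then show ?thesis
          using C_closed(3)[of g b] by (auto simp: mult_refl r_coset_def)
      next
        case (3 a)
        then show ?thesis
          using C_closed(3)[of a "inv h"] C_closed(2)[of h] by (auto simp: refl_mult r_coset_def)
      next
        case (4 a b)
        then show ?thesis
          using C_closed(3)[of a "inv b"] C_closed(2)[of b] by (simp add: refl_refl)
      qed (simp add: C_closed(3))
    qed (use C_closed x_C inv_t in \<open>auto simp: r_coset_def intro!: bexI[of _ \<one>]\<close>)
  qed
qed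

end

section \<open>Even \<open>n\<close>: the central involution and the hypotheses on
  \<open>M\<close>\<close>

locale even_dihedral = dihedral +
  assumes n_even: "even n"
begin

abbreviation z :: 'a where
  "z \<equiv> x [^] (n div 2)"

sublocale generalized_dihedral G C t z
proof (intro generalized_dihedral.intro generalized_dihedral_axioms.intro)
  show "finite C"
    using card_C n_pos card_ge_0_finite by metis
  show "z \<in> C" by (auto simp: C_eq)
  show "z \<noteq> \<one>"
    using n_pos n_even by (auto simp: x_pow_eq_one_iff dest!: dvd_imp_le)
  show "z \<otimes> z = \<one>"
    using n_even by (simp add: nat_pow_mult x_pow_n flip: mult_2)
next
  fix c assume "c \<in> C" "c \<otimes> c = \<one>"
  then obtain k :: nat where k: "c = x [^] k" "n dvd 2 * k"
    by (auto simp: C_eq nat_pow_mult x_pow_eq_one_iff mult_2)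
  \<comment> \<open>So \<open>c\<close> is a power of \<open>z\<close>, and the powers of
    \<open>z\<close> are \<open>\<one>\<close> and \<open>z\<close>.\<close>
  then have "n div 2 dvd k"
    using n_even by (auto elim!: evenE)
  then obtain j where j: "k = n div 2 * j" ..
  have "z [^] j = \<one> \<or> z [^] j = z"
  proof (induction j)
    case (Suc j)
    then show ?case
      using n_even by (auto simp: nat_pow_mult x_pow_n simp flip: mult_2)
  qed simp
  then show "c = \<one> \<or> c = z"
    by (simp add: k j nat_pow_pow)
qed (use group_axioms subgroup_C C_comm t_notin_C t_square t_conj carrier_eq in auto)

lemma generate_z: "generate G {z} = {\<one>, z}"
proof
  show "generate G {z} \<subseteq> {\<one>, z}"
    using normal_imp_subgroup[OF normal_center] by (intro generate_subgroup_incl) auto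
  show "{\<one>, z} \<subseteq> generate G {z}"
    by (auto intro: generate.one generate.incl)
qed

text \<open>Self-inverse elements cannot lie in a skew set, which excludes \<open>\<one>\<close> and
  \<open>z\<close>. For other \<open>a\<close>, maximality gives the inversion rule and the coset
  \<open>{a, z \<otimes> a}\<close> gives the rule for \<open>z\<close>.\<close>

lemma skew_transversalI:
  assumes skew: "maximal_skew (G\<lparr>carrier := C\<rparr>) M"
    and coset: "\<forall>K \<in> rcosets\<^bsub>G\<lparr>carrier := C\<rparr>\<^esub> (generate G {z}) - {generate G {z}}. \<exists>!m. m \<in> M \<inter> K"
    and u: "u = \<one> \<or> u = z"
  shows "skew_transversal G C t z M u"
proof unfold_locales
  have "set_inv\<^bsub>G\<lparr>carrier := C\<rparr>\<^esub> A = (\<lambda>a. inv a) ` A" if "A \<subseteq> C" for A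
    using subgroup_C that by (auto simp: SET_INV_def subset_iff)
  then have skew_iff: "skew (G\<lparr>carrier := C\<rparr>) A \<longleftrightarrow> A \<subseteq> C \<and> (\<forall>a\<in>A. inv a \<notin> A)" for A
    by (auto simp: skew_def)
  then have M: "M \<subseteq> C" "\<And>a. a \<in> M \<Longrightarrow> inv a \<notin> M"
    using skew by (auto simp: maximal_skew_def)
  moreover have "\<one> \<notin> M" "z \<notin> M"
    using M(2) inv_z by (metis inv_one)+
  ultimately show "M \<subseteq> C - {\<one>, z}" by blast
  fix a assume a: "a \<in> C" "a \<noteq> \<one>" "a \<noteq> z"
  then have a_inv: "inv a \<noteq> a" "a \<in> carrier G"
    using inv_eq_self_iff C_carrier by auto
  show "inv a \<in> M \<longleftrightarrow> a \<notin> M"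
  proof (rule iffI; rule ccontr)
    assume "inv a \<notin> M" "a \<notin> M"
    \<comment> \<open>Adjoining \<open>a\<close> keeps the set skew because \<open>a\<close> is not
      its own inverse; this contradicts maximality.\<close>
    moreover from this have "skew (G\<lparr>carrier := C\<rparr>) (insert a M)"
      using a a_inv M C_carrier by (auto simp: skew_iff)
    ultimately show False
      using skew by (auto simp: maximal_skew_def)
  qed (use M in auto)
  have "{\<one>, z} #>\<^bsub>G\<lparr>carrier := C\<rparr>\<^esub> a = {a, z \<otimes> a}"
    using a_inv by (auto simp: r_coset_def)
  moreover have "{a, z \<otimes> a} \<noteq> {\<one>, z}"
    using a by auto
  moreover have "{\<one>, z} #>\<^bsub>G\<lparr>carrier := C\<rparr>\<^esub> a \<in> rcosets\<^bsub>G\<lparr>carrier := C\<rparr>\<^esub> {\<one>, z}"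
    using a by (auto simp: RCOSETS_def)
  ultimately have "{a, z \<otimes> a} \<in> rcosets\<^bsub>G\<lparr>carrier := C\<rparr>\<^esub> {\<one>, z} - {{\<one>, z}}"
    by simp
  then have "\<exists>!m. m \<in> M \<inter> {a, z \<otimes> a}"
    by (rule bspec[OF coset[unfolded generate_z]])
  moreover have "z \<otimes> a \<noteq> a"
    using a_inv z_in_C z_neq_one C_carrier by simp
  ultimately show "z \<otimes> a \<in> M \<longleftrightarrow> a \<notin> M" by blast
qed (fact u)

end

theorem theorem6p1:
  fixes G (structure) and x t :: 'a and n :: nat and C N M S :: "'a set"
  assumes "n \<ge> 4" and "even n"
    and "is_dihedral n G x t"
  defines "C \<equiv> generate G {x}"
    and "N \<equiv> generate G {x [^] (n div 2)}"
  assumes "maximal_skew (G\<lparr>carrier := C\<rparr>) M"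
    and "\<forall>K \<in> rcosets\<^bsub>G\<lparr>carrier := C\<rparr>\<^esub> N - {N}. \<exists>!m. m \<in> M \<inter> K"
  defines "S \<equiv> M \<union> (M #> t)"
  shows "group_center G = {\<one>, x [^] (n div 2)}
    \<and> sum_set G (2 * n) (n - 1) ((n - 2) div 2) (S \<union> {t})
    \<and> type1 G (group_center G) (S \<union> {t})
    \<and> sum_set G (2 * n) (n - 1) ((n - 2) div 2) (S \<union> {x [^] (n div 2) \<otimes> t})
    \<and> type1 G (group_center G) (S \<union> {x [^] (n div 2) \<otimes> t})"
proof -
  interpret even_dihedral G n x t
    using assms(1-3) by unfold_locales auto
  have center: "group_center G = {\<one>, z}"
  \<comment> \<open>With at least 4 elements, \<open>C\<close> does not fit into
    \<open>{\<one>, z}\<close>.\<close>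
  proof (rule group_center_eq, rule ccontr)
    assume "\<not> (\<exists>d\<in>generate G {x}. d \<noteq> \<one> \<and> d \<noteq> z)"
    then have "card (generate G {x}) \<le> card {\<one>, z}"
      by (intro card_mono) auto
    then show False
      using assms(1) card_C z_neq_one by simp
  qed
  have result: "sum_set G (2 * n) (n - 1) ((n - 2) div 2) (S \<union> {u \<otimes> t})
      \<and> type1 G {\<one>, z} (S \<union> {u \<otimes> t})" if "u = \<one> \<or> u = z" for u
  proof -
    interpret skew_transversal G "generate G {x}" t z M u
      using skew_transversalI assms that by (simp add: C_def N_def)
    have "T = S \<union> {u \<otimes> t}"
      by (auto simp: T_def S_def r_coset_def)
    moreover have "2 * card M + 1 = n - 1" "card M = (n - 2) div 2"
      using double_card_M card_C assms(1) by auto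
    ultimately show ?thesis
      using sum_set_T type1_T card_C by simp
  qed
  from result[of \<one>] result[of z] show ?thesis
    by (simp add: center)
qed

end
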